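(* In the bounded square-loss game $(\Omega,\Gamma,\ell)=([0,1],[0,1],\ell)$ with $\ell(\omega,\gamma)=(\omega-\gamma)^2$, played according to the competitive prediction protocol, Sceptic has a strategy that guarantees $$\lim_{N\to\infty}\left|\gamma^{[1]}_N-\gamma^{[2]}_N\right|=0\quad\text{or}\quad\lim_{N\to\infty}\left(L^{[1]}_N-\tilde L_N\right)=\infty\quad\text{or}\quad\lim_{N\to\infty}\left(L^{[2]}_N-\tilde L_N\right)=\infty .$$
   Context: A game of prediction is a triple $(\Omega,\Gamma,\ell)$ where $\Omega$ (outcome space) and $\Gamma$ (prediction space) are sets and $\ell:\Omega\times\Gamma\to\mathbb{R}$ is the loss function. Competitive prediction protocol (perfect information; players: Nature, Predictor 1, Predictor 2, Sceptic): at each step $n=1,2,\ldots$, first Predictor 1 and Predictor 2 announce $\gamma_n^{[1]}\in\Gamma$ and $\gamma_n^{[2]}\in\Gamma$; then Sceptic announces $\tilde\gamma_n\in\Gamma$; then Nature announces $\omega_n\in\Omega$. A strategy for Sceptic is a function determining $\tilde\gamma_n$ from all moves made before it (the outcomes and all predictions of the steps before $n$, together with $\gamma_n^{[1]},\gamma_n^{[2]}$). It guarantees a property if the property holds for all sequences of moves of the other players when Sceptic follows it. Cumulative losses: $L_N^{[k]}=\sum_{n=1}^N\ell(\omega_n,\gamma_n^{[k]})$ for $k=1,2$, and $\tilde L_N=\sum_{n=1}^N\ell(\omega_n,\tilde\gamma_n)$. *)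

theory Defs
  imports "HOL-Analysis.Analysis"
begin

record ('w, 'g) prediction_game =
  outcomes :: "'w set"
  predictions :: "'g set"
  loss :: "'w \<Rightarrow> 'g \<Rightarrow> real"

text \<open>
  Steps are numbered from 0. A completed step is recorded as a tuple: the move of Predictor 1,
  the move of Predictor 2, the move of Sceptic, the move of Nature. A strategy for Sceptic maps
  the list of the completed steps (oldest first) and the two predictions just announced to
  Sceptic's prediction.
\<close>

type_synonym ('w, 'g) round = "'g \<times> 'g \<times> 'g \<times> 'w"

type_synonym ('w, 'g) strategy = "('w, 'g) round list \<Rightarrow> 'g \<Rightarrow> 'g \<Rightarrow> 'g"

definition is_sceptic_strategy :: "('w, 'g) prediction_game \<Rightarrow> ('w, 'g) strategy \<Rightarrow> bool" where
  "is_sceptic_strategy G S \<longleftrightarrow>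
     (\<forall>h a b. set h \<subseteq> predictions G \<times> predictions G \<times> predictions G \<times> outcomes G \<longrightarrow>
        a \<in> predictions G \<longrightarrow> b \<in> predictions G \<longrightarrow> S h a b \<in> predictions G)"

primrec history ::
  "('w, 'g) strategy \<Rightarrow> (nat \<Rightarrow> 'g) \<Rightarrow> (nat \<Rightarrow> 'g) \<Rightarrow> (nat \<Rightarrow> 'w) \<Rightarrow> nat \<Rightarrow> ('w, 'g) round list" where
  "history S g1 g2 w 0 = []"
| "history S g1 g2 w (Suc n) =
     history S g1 g2 w n @ [(g1 n, g2 n, S (history S g1 g2 w n) (g1 n) (g2 n), w n)]"

definition sceptic_moves ::
  "('w, 'g) strategy \<Rightarrow> (nat \<Rightarrow> 'g) \<Rightarrow> (nat \<Rightarrow> 'g) \<Rightarrow> (nat \<Rightarrow> 'w) \<Rightarrow> nat \<Rightarrow> 'g" where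
  "sceptic_moves S g1 g2 w n = S (history S g1 g2 w n) (g1 n) (g2 n)"

text \<open>
  The property is a predicate of the whole play: the moves of Predictor 1, Predictor 2,
  Sceptic and Nature, in this order. The opponents may see everything, but as a strategy is
  deterministic, quantifying over all their move sequences covers every way they can react.
\<close>

definition guarantees ::
  "('w, 'g) prediction_game \<Rightarrow> ('w, 'g) strategy \<Rightarrow>
   ((nat \<Rightarrow> 'g) \<Rightarrow> (nat \<Rightarrow> 'g) \<Rightarrow> (nat \<Rightarrow> 'g) \<Rightarrow> (nat \<Rightarrow> 'w) \<Rightarrow> bool) \<Rightarrow> bool" where
  "guarantees G S P \<longleftrightarrow>
     (\<forall>g1 g2 w. range g1 \<subseteq> predictions G \<longrightarrow> range g2 \<subseteq> predictions G \<longrightarrow>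
        range w \<subseteq> outcomes G \<longrightarrow> P g1 g2 (sceptic_moves S g1 g2 w) w)"

definition cumulative_loss ::
  "('w, 'g) prediction_game \<Rightarrow> (nat \<Rightarrow> 'w) \<Rightarrow> (nat \<Rightarrow> 'g) \<Rightarrow> nat \<Rightarrow> real" where
  "cumulative_loss G w g N = (\<Sum>n<N. loss G (w n) (g n))"

definition square_loss_game :: "(real, real) prediction_game" where
  "square_loss_game =
     \<lparr>outcomes = {0..1}, predictions = {0..1}, loss = (\<lambda>w g. (w - g)\<^sup>2)\<rparr>"

end

theory Submission
  imports Defs
begin

text \<open>
  Let \<open>u\<close> be the (scaled) difference of the predictors' losses. Sceptic mixes the two predictions,
  the second one with weight \<open>logistic (2 * u - v)\<close>, where \<open>v\<close> follows \<open>u\<close> with backlash: it moves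
  only as much as is needed to keep \<open>\<bar>u - v\<bar> \<le> 1\<close>. Compare Sceptic's regret with the potential
  \<open>(softplus (2 * u - v) + softplus v) / 2\<close>. A prediction gap \<open>d\<close> contributes a gain of order \<open>d\<^sup>2\<close>
  by the curvature of the square loss, as long as \<open>u\<close> and \<open>v\<close> remain bounded, and because of the
  hysteresis every upward move of \<open>v\<close> contributes a gain as well. If the total gain is infinite,
  Sceptic beats both predictors by an infinite margin. Otherwise \<open>v\<close> converges in the extended
  reals: an infinite limit means that Sceptic beats one of the predictors, as the potential is at
  least \<open>max 0 u\<close>, and a finite limit forces the gap to tend to 0.
\<close>

section \<open>The logistic function and its primitive \<open>softplus\<close>\<close>

definition logistic :: "real \<Rightarrow> real" where
  "logistic z = 1 / (1 + exp (- z))"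

definition softplus :: "real \<Rightarrow> real" where
  "softplus z = ln (1 + exp z)"

text \<open>Since \<open>softplus\<close> has derivative \<open>logistic\<close>, the derivative in
  \<open>u\<close> is \<open>logistic (2 * u - v)\<close>, the weight of the second
  prediction.\<close>

definition potential :: "real \<Rightarrow> real \<Rightarrow> real" where
  "potential u v = (softplus (2 * u - v) + softplus v) / 2"

definition backlash :: "real \<Rightarrow> real \<Rightarrow> real" where
  "backlash u v = max (u - 1) (min (u + 1) v)"

lemma one_plus_exp_pos: "0 < 1 + exp (z::real)"
  by (simp add: add_pos_pos)

lemma logistic_pos: "0 < logistic z" and logistic_less_1: "logistic z < 1"
  by (simp_all add: logistic_def one_plus_exp_pos)

lemma one_minus_logistic: "1 - logistic z = logistic (- z)"
proof -
  have "exp z * exp (- z) = 1"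
    by (simp add: exp_minus)
  then show ?thesis
    using one_plus_exp_pos[of z] one_plus_exp_pos[of "- z"]
    by (simp add: logistic_def field_simps)
qed

lemma mono_logistic: "x \<le> y \<Longrightarrow> logistic x \<le> logistic y"
  by (simp add: logistic_def frac_le one_plus_exp_pos)

lemma softplus_nonneg: "0 \<le> softplus z"
  by (simp add: softplus_def)

lemma softplus_minus: "softplus z - z = softplus (- z)"
proof -
  have "exp z * (1 + exp (- z)) = 1 + exp z"
    by (simp add: algebra_simps exp_minus)
  then have "ln (1 + exp z) = ln (exp z * (1 + exp (- z)))"
    by simp
  also have "\<dots> = z + ln (1 + exp (- z))"
    using one_plus_exp_pos[of "- z"] by (subst ln_mult_pos) auto
  finally show ?thesis
    by (simp add: softplus_def)
qed

lemma softplus_mono: "x \<le> y \<Longrightarrow> softplus x \<le> softplus y"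
  by (simp add: softplus_def one_plus_exp_pos)

text \<open>This is convexity of \<open>softplus\<close>; after exponentiation it amounts to
  \<open>(exp b - exp a) * (exp d - 1)\<close> being nonnegative.\<close>

lemma softplus_increment_mono:
  assumes "a \<le> b" "0 \<le> d"
  shows "softplus (a + d) - softplus a \<le> softplus (b + d) - softplus b"
proof -
  have "0 \<le> (exp b - exp a) * (exp d - 1)"
    using assms by simp
  then have "(1 + exp (a + d)) * (1 + exp b) \<le> (1 + exp (b + d)) * (1 + exp a)"
    by (simp add: algebra_simps exp_add)
  then have "ln ((1 + exp (a + d)) * (1 + exp b)) \<le> ln ((1 + exp (b + d)) * (1 + exp a))"
    by (simp add: one_plus_exp_pos)
  then show ?thesis
    by (simp add: softplus_def ln_mult_pos one_plus_exp_pos)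
qed

lemma exp_le_quadratic:
  fixes t :: real
  assumes "t \<le> 1"
  shows "exp t \<le> 1 + t + t\<^sup>2"
proof (cases "0 \<le> t")
  case True
  then show ?thesis using assms by (rule exp_bound)
next
  case False
  define s where "s = - t"
  have s: "0 \<le> s" using False by (simp add: s_def)
  have "0 \<le> 1 - s + s\<^sup>2"
    using sum_squares_ge_zero[of "s - 1" s] s by (simp add: power2_eq_square algebra_simps)
  \<comment> \<open>It suffices that \<open>1 - s + s\<^sup>2\<close> times the quadratic Taylor
    bound for \<open>exp s\<close> is at least 1.\<close>
  then have "(1 - s + s\<^sup>2) * (1 + s + s\<^sup>2 / 2) \<le> (1 - s + s\<^sup>2) * exp s"
    using exp_lower_Taylor_quadratic[OF s] by (rule mult_left_mono[rotated])
  moreover have "(1 - s + s\<^sup>2) * (1 + s + s\<^sup>2 / 2) = 1 + (s^2 + s^3 + s^4) / 2"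
    by (simp add: eval_nat_numeral field_simps)
  moreover have "1 \<le> 1 + (s^2 + s^3 + s^4) / 2"
    using s by simp
  ultimately have "1 \<le> (1 - s + s\<^sup>2) * exp s" by (metis order_trans)
  then have "exp (- s) \<le> 1 - s + s\<^sup>2"
    by (simp add: exp_minus field_simps)
  then show ?thesis by (simp add: s_def)
qed

text \<open>The increment of \<open>softplus\<close> is the log moment generating function of a
  Bernoulli variable with mean \<open>q\<close>. Centring that variable extracts
  \<open>q * h\<close>; the bound \<open>ln x \<le> x - 1\<close> and the quadratic bound on
  \<open>exp\<close> leave its variance times \<open>h\<^sup>2\<close>.\<close>

lemma softplus_step:
  fixes h z :: real
  assumes "\<bar>h\<bar> \<le> 1 / 2"
  defines "q \<equiv> logistic z"
  shows "softplus (z + h) \<le> softplus z + q * h + q * (1 - q) * h\<^sup>2"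
proof -
  define p where "p = 1 - q"
  have q: "0 < q" "q < 1" and p: "0 < p" "p < 1" "p + q = 1"
    using logistic_pos[of z] logistic_less_1[of z] by (auto simp: p_def q_def)
  have "\<bar>q * h\<bar> \<le> 1 / 2" "\<bar>p * h\<bar> \<le> 1 / 2"
    using assms(1) p q mult_mono[of q 1 "\<bar>h\<bar>" "1/2"] mult_mono[of p 1 "\<bar>h\<bar>" "1/2"]
    by (auto simp: abs_mult)
  then have e: "exp (- (q * h)) \<le> 1 - q * h + (q * h)\<^sup>2" "exp (p * h) \<le> 1 + p * h + (p * h)\<^sup>2"
    using exp_le_quadratic[of "- (q * h)"] exp_le_quadratic[of "p * h"] by auto
  have "1 + exp (z + h) = (1 + exp z) * (p + q * exp h)"
    using one_minus_logistic[of z] one_plus_exp_pos[of z] one_plus_exp_pos[of "- z"]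
    by (simp add: p_def q_def logistic_def exp_add exp_minus field_simps)
  \<comment> \<open>Centring: the deviations from the mean \<open>q\<close> are \<open>- q\<close>
    and \<open>p\<close>, so the linear terms cancel below.\<close>
  also have "p + q * exp h = exp (q * h) * (p * exp (- (q * h)) + q * exp (p * h))"
    using p by (simp add: algebra_simps flip: exp_add distrib_left)
  finally have "softplus (z + h)
      = softplus z + q * h + ln (p * exp (- (q * h)) + q * exp (p * h))"
    using p q one_plus_exp_pos[of z] by (simp add: softplus_def ln_mult_pos add_pos_pos)
  also have "ln (p * exp (- (q * h)) + q * exp (p * h))
      \<le> p * exp (- (q * h)) + q * exp (p * h) - 1"
    using p q by (intro ln_le_minus_one) (simp add: add_pos_pos)
  also have "\<dots> \<le> p * (1 - q * h + (q * h)\<^sup>2) + q * (1 + p * h + (p * h)\<^sup>2) - 1"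
    using e p q by (intro diff_right_mono add_mono mult_left_mono) auto
  also have "\<dots> = (p + q) + (p + q) * (p * q * h\<^sup>2) - 1"
    by (simp add: algebra_simps power2_eq_square)
  finally show ?thesis
    using p by (simp add: p_def mult.commute)
qed

section \<open>The potential under backlash moves\<close>

lemma potential_nonneg: "0 \<le> potential u v"
  by (simp add: potential_def softplus_nonneg)

text \<open>Here \<open>softplus z \<ge> z\<close>, and the two arguments \<open>2 * u - v\<close>
  and \<open>v\<close> average to \<open>u\<close>.\<close>

lemma potential_ge: "u \<le> potential u v"
  using softplus_minus[of "2 * u - v"] softplus_minus[of v] softplus_nonneg[of "- v"]
    softplus_nonneg[of "- (2 * u - v)"]
  by (simp add: potential_def)

lemma abs_backlash: "\<bar>u - backlash u v\<bar> \<le> 1"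
  by (auto simp: backlash_def)

text \<open>An upward push ends at \<open>v = u - 1\<close>, where the arguments of
  \<open>softplus\<close> in the potential are \<open>v + 2\<close> and \<open>v\<close>. This
  function measures the gain collected by such pushes.\<close>

definition hysteresis :: "real \<Rightarrow> real" where
  "hysteresis v = softplus (v + 2) - softplus v"

lemma hysteresis_mono: "x \<le> y \<Longrightarrow> hysteresis x \<le> hysteresis y"
  unfolding hysteresis_def by (intro softplus_increment_mono) auto

text \<open>The points \<open>2 * u - v\<close> and \<open>v\<close> are symmetric about
  \<open>u\<close> and a backlash move pulls them together, so convexity lowers the potential. In an
  upward move the first \<open>softplus\<close> falls by at least its increment from
  \<open>v + 2\<close> to \<open>v' + 2\<close>, while the second rises by its increment from
  \<open>v\<close> to \<open>v'\<close>; the difference is the increase of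
  \<open>hysteresis\<close>. In a downward move \<open>hysteresis\<close> does not increase.\<close>

lemma potential_backlash:
  fixes u v :: real
  defines "v' \<equiv> backlash u v"
  shows "potential u v' \<le> potential u v"
    and "potential u v' + (hysteresis v' - hysteresis v) / 2 \<le> potential u v"
proof -
  consider "v' = v" | "v' = u - 1" "v < v'" | "v' = u + 1" "v' < v"
    unfolding v'_def backlash_def by linarith
  then have "potential u v' \<le> potential u v \<and>
      potential u v' + (hysteresis v' - hysteresis v) / 2 \<le> potential u v"
  proof cases
    case 1
    then show ?thesis by simp
  next
    case 2
    \<comment> \<open>Two adjacent intervals of length \<open>v' - v\<close> are compared, ending
      and starting at \<open>v' + 2\<close>.\<close>
    have "softplus (v + 2 + (v' - v)) - softplus (v + 2)
        \<le> softplus (v' + 2 + (v' - v)) - softplus (v' + 2)"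
      using 2 by (intro softplus_increment_mono) auto
    moreover have "hysteresis v \<le> hysteresis v'"
      using 2 by (intro hysteresis_mono) auto
    moreover have eqs: "2 * u - v = v' + 2 + (v' - v)" "2 * u - v' = v' + 2"
      "v + 2 + (v' - v) = v' + 2"
      using 2 by auto
    ultimately show ?thesis
      unfolding potential_def hysteresis_def eqs by argo
  next
    case 3
    have "softplus (v' - 2 - (v - v') + (v - v')) - softplus (v' - 2 - (v - v'))
        \<le> softplus (v' + (v - v')) - softplus v'"
      using 3 by (intro softplus_increment_mono) auto
    moreover have "hysteresis v' \<le> hysteresis v"
      using 3 by (intro hysteresis_mono) auto
    moreover have eqs: "2 * u - v = v' - 2 - (v - v')" "2 * u - v' = v' - 2"
      "v' - 2 - (v - v') + (v - v') = v' - 2" "v' + (v - v') = v"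
      using 3 by auto
    ultimately show ?thesis
      unfolding potential_def eqs by argo
  qed
  then show "potential u v' \<le> potential u v"
    and "potential u v' + (hysteresis v' - hysteresis v) / 2 \<le> potential u v"
    by auto
qed

section \<open>Recovering the behaviour of \<open>v\<close> from a limit of
  \<open>hysteresis\<close>\<close>

lemma hysteresis_eq: "hysteresis v = ln (exp 2 - (exp 2 - 1) * logistic (- v))"
proof -
  have "hysteresis v = ln ((1 + exp (v + 2)) / (1 + exp v))"
    using one_plus_exp_pos[of v] one_plus_exp_pos[of "v + 2"]
    by (simp add: hysteresis_def softplus_def ln_div)
  also have "(1 + exp (v + 2)) / (1 + exp v) = exp 2 - (exp 2 - 1) * logistic (- v)"
    using one_plus_exp_pos[of v] by (simp add: logistic_def exp_add divide_simps) (simp add: algebra_simps)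
  finally show ?thesis .
qed

lemma logistic_less_iff: "logistic x < logistic y \<longleftrightarrow> x < y"
  by (auto simp: logistic_def frac_less2 one_plus_exp_pos divide_simps add_pos_pos not_less)

text \<open>Solving \<open>hysteresis_eq\<close> for \<open>logistic (- v)\<close> turns the limit
  into a limit \<open>r\<close> in [0, 1] of \<open>logistic (- v n)\<close>. The endpoints 0 and 1
  correspond to the two infinite limits of \<open>v\<close>, an interior \<open>r\<close> to a
  bounded tail.\<close>

lemma convergent_hysteresis_trichotomy:
  fixes v :: "nat \<Rightarrow> real"
  assumes "convergent (\<lambda>n. hysteresis (v n))"
  shows "filterlim v at_top sequentially \<or> filterlim v at_bot sequentially \<or>
    (\<exists>B. \<forall>\<^sub>F n in sequentially. \<bar>v n\<bar> \<le> B)"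
proof -
  obtain L where "(\<lambda>n. hysteresis (v n)) \<longlonglongrightarrow> L"
    using assms by (auto simp: convergent_def)
  then have "(\<lambda>n. (exp 2 - exp (hysteresis (v n))) / (exp 2 - 1))
      \<longlonglongrightarrow> (exp 2 - exp L) / (exp 2 - 1)" (is "_ \<longlonglongrightarrow> ?r")
    by (intro tendsto_intros) auto
  moreover have "(exp 2 - exp (hysteresis x)) / (exp 2 - 1) = logistic (- x)" for x
  proof -
    have "exp 2 - 1 > (0::real)" by simp
    then have "(exp 2 - 1) * logistic (- x) < exp 2 - 1"
      using logistic_less_1[of "- x"] by simp
    then have "0 < exp 2 - (exp 2 - 1) * logistic (- x)" by linarith
    then show ?thesis by (simp add: hysteresis_eq)
  qed
  ultimately obtain r where r: "(\<lambda>n. logistic (- v n)) \<longlonglongrightarrow> r" by auto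
  have r0: "0 \<le> r"
    by (rule tendsto_lowerbound[OF r]) (auto intro: always_eventually less_imp_le logistic_pos)
  have r1: "r \<le> 1"
    by (rule tendsto_upperbound[OF r]) (auto intro: always_eventually less_imp_le logistic_less_1)
  have top: "\<forall>\<^sub>F n in sequentially. Z < v n" if "r < logistic (- Z)" for Z
    using order_tendstoD(2)[OF r that] by (simp add: logistic_less_iff)
  have bot: "\<forall>\<^sub>F n in sequentially. v n < Z" if "logistic (- Z) < r" for Z
    using order_tendstoD(1)[OF r that] by (simp add: logistic_less_iff)
  have surj: "\<exists>Z. logistic (- Z) = s" if "0 < s" "s < 1" for s
  proof
    show "logistic (- ln (1 / s - 1)) = s"
      using that by (simp add: logistic_def)
  qed
  consider "r = 0" | "r = 1" | "0 < r" "r < 1"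
    using r0 r1 by linarith
  then show ?thesis
  proof cases
    case 1
    then have "filterlim v at_top sequentially"
      using top by (auto simp: filterlim_at_top_dense logistic_pos)
    then show ?thesis by simp
  next
    case 2
    then have "filterlim v at_bot sequentially"
      using bot by (auto simp: filterlim_at_bot_dense logistic_less_1)
    then show ?thesis by simp
  next
    case 3
    \<comment> \<open>The values \<open>r / 2\<close> and \<open>(1 + r) / 2\<close> lie in (0, 1)
      on either side of \<open>r\<close>, so \<open>Y\<close> and \<open>Z\<close> eventually
      enclose \<open>v n\<close>.\<close>
    obtain Y Z where "logistic (- Y) = r / 2" "logistic (- Z) = (1 + r) / 2"
      using surj[of "r / 2"] surj[of "(1 + r) / 2"] 3 by auto
    then have "\<forall>\<^sub>F n in sequentially. v n < Y" "\<forall>\<^sub>F n in sequentially. Z < v n"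
      using 3 bot[of Y] top[of Z] by auto
    then have "\<forall>\<^sub>F n in sequentially. \<bar>v n\<bar> \<le> max \<bar>Y\<bar> \<bar>Z\<bar>"
      by eventually_elim auto
    then show ?thesis by blast
  qed
qed

section \<open>The game reduced to real sequences\<close>

text \<open>In the application \<open>X\<close> and \<open>X - u\<close> are Sceptic's advantages
  over Predictors 1 and 2, divided by 16, and \<open>d\<close> is the prediction gap. The surplus
  \<open>G\<close> of \<open>X\<close> over the potential grows both with the gap and with
  \<open>hysteresis (v n)\<close>.\<close>

lemma regret_alternatives:
  fixes u v X d :: "nat \<Rightarrow> real"
  defines "q \<equiv> \<lambda>n. logistic (2 * u n - v n)"
  assumes "\<bar>u 0 - v 0\<bar> \<le> 1"
    and v_Suc: "\<And>n. v (Suc n) = backlash (u (Suc n)) (v n)"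
    and u_Suc: "\<And>n. \<bar>u (Suc n) - u n\<bar> \<le> \<bar>d n\<bar> / 8"
    and d_le_1: "\<And>n. \<bar>d n\<bar> \<le> 1"
    and X_Suc: "\<And>n. X (Suc n) = X n + q n * (u (Suc n) - u n) + q n * (1 - q n) * (d n)\<^sup>2 / 16"
  shows "(\<lambda>n. \<bar>d n\<bar>) \<longlonglongrightarrow> 0 \<or> filterlim X at_top sequentially \<or>
    filterlim (\<lambda>n. X n - u n) at_top sequentially"
proof -
  define G where "G n = X n - potential (u n) (v n)" for n
  have uv: "\<bar>u n - v n\<bar> \<le> 1" for n
    using assms(2) by (cases n) (auto simp: v_Suc abs_backlash)
  have q: "0 < q n" "q n < 1" for n
    by (simp_all add: q_def logistic_pos logistic_less_1)
  \<comment> \<open>Only \<open>u\<close> moves here. Curvature gains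
    \<open>q * (1 - q) * d\<^sup>2 / 16\<close>, and the second-order term of the potential costs at
    most half of that.\<close>
  have step: "potential (u (Suc n)) (v n) + q n * (1 - q n) * (d n)\<^sup>2 / 32
      \<le> potential (u n) (v n) + X (Suc n) - X n" for n
  proof -
    let ?s = "u (Suc n) - u n"
    have "\<bar>?s\<bar> \<le> 1 / 8"
      using u_Suc[of n] d_le_1[of n] by linarith
    then have "\<bar>2 * ?s\<bar> \<le> 1 / 2"
      by (subst abs_mult) simp
    then have "softplus ((2 * u n - v n) + 2 * ?s)
        \<le> softplus (2 * u n - v n) + q n * (2 * ?s) + q n * (1 - q n) * (2 * ?s)\<^sup>2"
      unfolding q_def by (rule softplus_step)
    moreover have "q n * (1 - q n) * (2 * ?s)\<^sup>2 \<le> q n * (1 - q n) * ((d n)\<^sup>2 / 16)"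
    proof (rule mult_left_mono)
      have "\<bar>2 * ?s\<bar> \<le> \<bar>d n / 4\<bar>"
        using u_Suc[of n] by (subst abs_mult) simp
      then have "(2 * ?s)\<^sup>2 \<le> (d n / 4)\<^sup>2"
        by (simp only: abs_le_square_iff)
      then show "(2 * ?s)\<^sup>2 \<le> (d n)\<^sup>2 / 16"
        by (simp add: power_divide)
      show "0 \<le> q n * (1 - q n)" using q[of n] by simp
    qed
    moreover have "(2 * u n - v n) + 2 * ?s = 2 * u (Suc n) - v n" by simp
    ultimately show ?thesis
      by (simp add: potential_def X_Suc field_simps)
  qed
  have gap: "q n * (1 - q n) * (d n)\<^sup>2 / 32 \<le> G (Suc n) - G n" for n
    using step[of n] potential_backlash(1)[of "u (Suc n)" "v n"] by (simp add: G_def v_Suc)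
  have gap_nonneg: "0 \<le> q n * (1 - q n) * (d n)\<^sup>2 / 32" for n
    using q[of n] by simp
  \<comment> \<open>Any increase of \<open>hysteresis\<close> is paid for by at least half as large
    an increase of \<open>G\<close>.\<close>
  have hyst: "hysteresis (v (Suc n)) - 2 * G (Suc n) \<le> hysteresis (v n) - 2 * G n" for n
    using step[of n] potential_backlash(2)[of "u (Suc n)" "v n"] gap_nonneg[of n]
    unfolding G_def v_Suc by (simp add: field_simps)
  have inc: "incseq G"
    using order_trans[OF gap_nonneg gap] by (intro incseq_SucI) simp
  show ?thesis
  proof (cases "\<exists>C. \<forall>n. G n \<le> C")
    case False
    have "filterlim G at_top sequentially"
      unfolding filterlim_at_top
    proof
      fix Z
      obtain m where "Z < G m" using False by (meson not_le)
      then show "\<forall>\<^sub>F n in sequentially. Z \<le> G n"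
        using incseqD[OF inc] by (intro eventually_sequentiallyI[of m]) (meson less_imp_le order_trans)
    qed
    then have "filterlim X at_top sequentially"
      by (rule filterlim_at_top_mono) (auto simp: G_def potential_nonneg)
    then show ?thesis by simp
  next
    case True
    then obtain C where C: "\<And>n. G n \<le> C" by auto
    then obtain g where g: "G \<longlonglongrightarrow> g"
      using incseq_convergent[OF inc, of C] by blast
    have G0: "G 0 \<le> G n" for n
      using inc by (simp add: incseqD)
    \<comment> \<open>A decreasing sequence bounded below; adding back the convergent
      \<open>2 * G n\<close> leaves \<open>hysteresis (v n)\<close>.\<close>
    have "convergent (\<lambda>n. hysteresis (v n) - 2 * G n)"
    proof -
      have dec: "decseq (\<lambda>n. hysteresis (v n) - 2 * G n)"
        using hyst by (rule decseq_SucI)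
      moreover have "- 2 * C \<le> hysteresis (v n) - 2 * G n" for n
        using C[of n] softplus_mono[of "v n" "v n + 2"] by (simp add: hysteresis_def)
      ultimately show ?thesis
        using decseq_convergent[OF dec, of "- 2 * C"] unfolding convergent_def by blast
    qed
    then have "convergent (\<lambda>n. hysteresis (v n) - 2 * G n + 2 * G n)"
      using g by (intro convergent_add convergent_mult convergent_const convergentI[of G g])
    then have "convergent (\<lambda>n. hysteresis (v n))" by simp
    then consider "filterlim v at_top sequentially" | "filterlim v at_bot sequentially"
      | B where "\<forall>\<^sub>F n in sequentially. \<bar>v n\<bar> \<le> B"
      using convergent_hysteresis_trichotomy by blast
    then show ?thesis
    proof cases
      case 1
      then have "filterlim (\<lambda>n. (G 0 - 1) + v n) at_top sequentially"
        by (intro filterlim_tendsto_add_at_top[OF tendsto_const])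
      moreover have "(G 0 - 1) + v n \<le> X n" for n
        using G0[of n] uv[of n] potential_ge[of "u n" "v n"] by (simp add: G_def)
      ultimately have "filterlim X at_top sequentially"
        by (auto intro: filterlim_at_top_mono)
      then show ?thesis by simp
    next
      case 2
      then have "filterlim (\<lambda>n. (G 0 - 1) + - v n) at_top sequentially"
        by (intro filterlim_tendsto_add_at_top[OF tendsto_const]) (simp add: filterlim_uminus_at_bot)
      moreover have "(G 0 - 1) + - v n \<le> X n - u n" for n
        using G0[of n] uv[of n] potential_nonneg[of "u n" "v n"] by (simp add: G_def)
      ultimately have "filterlim (\<lambda>n. X n - u n) at_top sequentially"
        by (auto intro: filterlim_at_top_mono)
      then show ?thesis by simp
    next
      case 3
      \<comment> \<open>From \<open>\<bar>v n\<bar> \<le> B\<close> and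
        \<open>\<bar>u n - v n\<bar> \<le> 1\<close> follows
        \<open>\<bar>2 * u n - v n\<bar> \<le> B + 2\<close>, so both weights are at least
        \<open>logistic (- (B + 2))\<close>; 32 comes from \<open>gap\<close>.\<close>
      define k where "k = logistic (- (B + 2)) * logistic (- (B + 2)) / 32"
      have k: "0 < k" by (simp add: k_def logistic_pos)
      have "(\<lambda>n. (G (Suc n) - G n) / k) \<longlonglongrightarrow> (g - g) / k"
        using g k by (intro tendsto_intros LIMSEQ_Suc) auto
      then have lim: "(\<lambda>n. (G (Suc n) - G n) / k) \<longlonglongrightarrow> 0" by simp
      have bound: "\<forall>\<^sub>F n in sequentially. (d n)\<^sup>2 \<le> (G (Suc n) - G n) / k"
        using 3
      proof eventually_elim
        case (elim n)
        have "logistic (- (B + 2)) * logistic (- (B + 2)) \<le> q n * (1 - q n)"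
          unfolding q_def one_minus_logistic using elim uv[of n]
          by (intro mult_mono mono_logistic) (auto simp: logistic_pos less_imp_le)
        then have "k * (d n)\<^sup>2 \<le> q n * (1 - q n) / 32 * (d n)\<^sup>2"
          by (intro mult_right_mono) (auto simp: k_def)
        also have "\<dots> \<le> G (Suc n) - G n" using gap[of n] by simp
        finally show ?case using k by (simp add: field_simps)
      qed
      have "(\<lambda>n. (d n)\<^sup>2) \<longlonglongrightarrow> 0"
        by (rule tendsto_sandwich[OF _ bound tendsto_const lim]) simp
      then have "(\<lambda>n. sqrt ((d n)\<^sup>2)) \<longlonglongrightarrow> sqrt 0"
        by (rule tendsto_real_sqrt)
      then show ?thesis by simp
    qed
  qed
qed

section \<open>The strategy and its guarantee\<close>

text \<open>Dividing by 16 keeps each move of \<open>u\<close> within 1/8 of the gap, small enough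
  for \<open>softplus_step\<close>.\<close>

fun backlash_step :: "real \<times> real \<Rightarrow> (real, real) round \<Rightarrow> real \<times> real" where
  "backlash_step (u, v) (a, b, _, w) =
     (let u' = u + ((w - a)\<^sup>2 - (w - b)\<^sup>2) / 16 in (u', backlash u' v))"

definition backlash_state :: "(real, real) round list \<Rightarrow> real \<times> real" where
  "backlash_state h = foldl backlash_step (0, 0) h"

definition backlash_strategy :: "(real, real) strategy" where
  "backlash_strategy h a b =
     (let (u, v) = backlash_state h; q = logistic (2 * u - v) in (1 - q) * a + q * b)"

lemma is_sceptic_strategy_backlash: "is_sceptic_strategy square_loss_game backlash_strategy"
proof -
  have "(1 - logistic z) * a + logistic z * b \<in> {0..1}" if "a \<in> {0..1}" "b \<in> {0..1}" for a b z
  proof -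
    have "convex {0..1::real}" by simp
    then show ?thesis
      using convexD[of "{0..1}" a b "1 - logistic z" "logistic z"] that
        logistic_pos[of z] logistic_less_1[of z] by auto
  qed
  then show ?thesis
    by (simp add: is_sceptic_strategy_def square_loss_game_def backlash_strategy_def case_prod_beta Let_def)
qed

text \<open>Bias-variance decomposition: the loss of the mean \<open>c\<close> is the mean loss
  minus the variance \<open>q * (1 - q) * (a - b)\<^sup>2\<close>.\<close>

lemma square_loss_mix:
  fixes a b q w :: real
  defines "c \<equiv> (1 - q) * a + q * b"
  shows "(w - a)\<^sup>2 - (w - c)\<^sup>2 = q * ((w - a)\<^sup>2 - (w - b)\<^sup>2) + q * (1 - q) * (a - b)\<^sup>2"
  unfolding c_def by (simp add: power2_eq_square algebra_simps)

theorem proposition3: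
  shows "\<exists>S. is_sceptic_strategy square_loss_game S \<and>
    guarantees square_loss_game S (\<lambda>g1 g2 g w.
      (\<lambda>N. \<bar>g1 N - g2 N\<bar>) \<longlonglongrightarrow> 0 \<or>
      filterlim (\<lambda>N. cumulative_loss square_loss_game w g1 N - cumulative_loss square_loss_game w g N)
        at_top sequentially \<or>
      filterlim (\<lambda>N. cumulative_loss square_loss_game w g2 N - cumulative_loss square_loss_game w g N)
        at_top sequentially)"
proof (intro exI conjI)
  show "is_sceptic_strategy square_loss_game backlash_strategy"
    by (rule is_sceptic_strategy_backlash)
  show "guarantees square_loss_game backlash_strategy (\<lambda>g1 g2 g w.
      (\<lambda>N. \<bar>g1 N - g2 N\<bar>) \<longlonglongrightarrow> 0 \<or>
      filterlim (\<lambda>N. cumulative_loss square_loss_game w g1 N - cumulative_loss square_loss_game w g N)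
        at_top sequentially \<or>
      filterlim (\<lambda>N. cumulative_loss square_loss_game w g2 N - cumulative_loss square_loss_game w g N)
        at_top sequentially)"
    unfolding guarantees_def
  proof (intro allI impI)
    fix g1 g2 w :: "nat \<Rightarrow> real"
    assume "range g1 \<subseteq> predictions square_loss_game" "range g2 \<subseteq> predictions square_loss_game"
      "range w \<subseteq> outcomes square_loss_game"
    then have g1: "0 \<le> g1 n" "g1 n \<le> 1" and g2: "0 \<le> g2 n" "g2 n \<le> 1"
      and w: "0 \<le> w n" "w n \<le> 1" for n
      by (auto simp: square_loss_game_def image_subset_iff)
    let ?g = "sceptic_moves backlash_strategy g1 g2 w"
    let ?L = "cumulative_loss square_loss_game w"
    define st where "st n = backlash_state (history backlash_strategy g1 g2 w n)" for n
    define u v where "u n = fst (st n)" and "v n = snd (st n)" for n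
    define X where "X n = (?L g1 n - ?L ?g n) / 16" for n
    have L_Suc: "?L f (Suc n) = ?L f n + (w n - f n)\<^sup>2" for f n
      by (simp add: cumulative_loss_def square_loss_game_def)
    have "(u (Suc n), v (Suc n)) = backlash_step (u n, v n) (g1 n, g2 n, ?g n, w n)" for n
      by (simp add: st_def u_def v_def backlash_state_def sceptic_moves_def)
    then have u_Suc: "u (Suc n) = u n + ((w n - g1 n)\<^sup>2 - (w n - g2 n)\<^sup>2) / 16"
      and v_Suc: "v (Suc n) = backlash (u (Suc n)) (v n)" for n
      by (simp_all add: Let_def)
    have g: "?g n = (1 - logistic (2 * u n - v n)) * g1 n + logistic (2 * u n - v n) * g2 n" for n
      by (simp add: sceptic_moves_def backlash_strategy_def case_prod_beta Let_def u_def v_def st_def)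
    have u: "u n = (?L g1 n - ?L g2 n) / 16" for n
    proof (induction n)
      case 0
      then show ?case
        by (simp add: u_def st_def backlash_state_def cumulative_loss_def)
    next
      case (Suc n)
      then show ?case by (simp add: u_Suc L_Suc field_simps)
    qed
    have "(\<lambda>n. \<bar>g1 n - g2 n\<bar>) \<longlonglongrightarrow> 0 \<or> filterlim X at_top sequentially \<or>
        filterlim (\<lambda>n. X n - u n) at_top sequentially"
    proof (rule regret_alternatives)
      show "\<bar>u 0 - v 0\<bar> \<le> 1"
        by (simp add: u_def v_def st_def backlash_state_def)
    next
      fix n
      show "v (Suc n) = backlash (u (Suc n)) (v n)" by (rule v_Suc)
      \<comment> \<open>The second factor is at most 2 in absolute value, and 2 / 16 is the required
        1/8.\<close>
      have "(w n - g1 n)\<^sup>2 - (w n - g2 n)\<^sup>2 = (g1 n - g2 n) * (g1 n + g2 n - 2 * w n)"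
        by (simp add: power2_eq_square algebra_simps)
      moreover have "\<bar>g1 n - g2 n\<bar> * \<bar>g1 n + g2 n - 2 * w n\<bar> \<le> \<bar>g1 n - g2 n\<bar> * 2"
        using g1[of n] g2[of n] w[of n] by (intro mult_left_mono) auto
      ultimately show "\<bar>u (Suc n) - u n\<bar> \<le> \<bar>g1 n - g2 n\<bar> / 8"
        by (simp add: u_Suc abs_mult)
      show "\<bar>g1 n - g2 n\<bar> \<le> 1" using g1[of n] g2[of n] by auto
      show "X (Suc n) = X n + logistic (2 * u n - v n) * (u (Suc n) - u n)
          + logistic (2 * u n - v n) * (1 - logistic (2 * u n - v n)) * (g1 n - g2 n)\<^sup>2 / 16"
        using square_loss_mix[of "w n" "g1 n" "logistic (2 * u n - v n)" "g2 n"]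
        by (simp add: X_def L_Suc u_Suc g field_simps)
    qed
    moreover have L: "?L g1 n - ?L ?g n = 16 * X n" "?L g2 n - ?L ?g n = 16 * (X n - u n)" for n
      by (simp_all add: X_def u field_simps)
    ultimately show "(\<lambda>N. \<bar>g1 N - g2 N\<bar>) \<longlonglongrightarrow> 0 \<or>
        filterlim (\<lambda>N. ?L g1 N - ?L ?g N) at_top sequentially \<or>
        filterlim (\<lambda>N. ?L g2 N - ?L ?g N) at_top sequentially"
      unfolding L using filterlim_tendsto_pos_mult_at_top[OF tendsto_const, of 16 X sequentially]
        filterlim_tendsto_pos_mult_at_top[OF tendsto_const, of 16 "\<lambda>n. X n - u n" sequentially]
      by argo
  qed
qed

end
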